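(* For all $f\in C_{\phi}([0,\infty))$ and all $n\in\mathbb{N}$ ($n\ge 1$), $$\|V_n^{\rho}(f;\cdot)-f\|_{\phi^{3/2}}\le\left(7+\frac{4}{n}\right)\omega_{\rho}\left(f;\frac{2\sqrt{2}}{\sqrt{n}}+\frac{16}{n}\right).$$
   Context: Let $\rho:[0,\infty)\to\mathbb{R}$ be continuously differentiable on $[0,\infty)$ with $\rho(0)=0$ and $\inf_{x\in[0,\infty)}\rho'(x)\ge 1$ (so $\rho$ is a bijection of $[0,\infty)$ onto itself, with inverse $\rho^{-1}$). For $n\in\mathbb{N}$ ($n\ge 1$), $x\in[0,\infty)$ and $f:[0,\infty)\to\mathbb{R}$ for which the series converges, the generalized Baskakov operator is $$V_n^{\rho}(f;x)=\sum_{k=0}^{\infty}(f\circ\rho^{-1})\left(\frac{k}{n}\right)\binom{n+k-1}{k}\frac{(\rho(x))^k}{(1+\rho(x))^{n+k}} .$$ Put $\phi(x)=1+\rho^2(x)$, where $\rho^2(x)=(\rho(x))^2$. $B_{\phi}([0,\infty))$ is the set of all $f:[0,\infty)\to\mathbb{R}$ for which there is a constant $M_f$ (depending on $f$) with $|f(x)|\le M_f\phi(x)$ for all $x\in[0,\infty)$, and $C_{\phi}([0,\infty))$ is the set of all continuous functions in $B_{\phi}([0,\infty))$. The norm with weight $\phi^{3/2}$ is $\|g\|_{\phi^{3/2}}=\sup_{x\in[0,\infty)}\frac{|g(x)|}{\phi(x)^{3/2}}$. For $f\in C_{\phi}([0,\infty))$ and $\delta>0$ the weighted modulus of continuity is $$\omega_{\rho}(f;\delta)=\sup_{\substack{x,t\in[0,\infty)\\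 |\rho(x)-\rho(t)|\le\delta}}\frac{|f(t)-f(x)|}{\phi(t)+\phi(x)} .$$ *)

theory Defs
  imports "HOL-Analysis.Analysis" "HOL-Real_Asymp.Real_Asymp"
begin

text \<open>Functions on the half-line are modelled as total functions on the reals of which only
  the values on \<open>{0..}\<close> matter; in particular the derivative at 0 is one-sided.\<close>

definition admissible :: "(real \<Rightarrow> real) \<Rightarrow> bool" where
  "admissible \<rho> \<longleftrightarrow> \<rho> 0 = 0 \<and>
     (\<exists>\<rho>'. (\<forall>x\<in>{0..}. (\<rho> has_real_derivative \<rho>' x) (at x within {0..})) \<and>
           continuous_on {0..} \<rho>' \<and> (INF x\<in>{0..}. ereal (\<rho>' x)) \<ge> 1)"

definition baskakov_term :: "(real \<Rightarrow> real) \<Rightarrow> nat \<Rightarrow> (real \<Rightarrow> real) \<Rightarrow> real \<Rightarrow> nat \<Rightarrow> real" where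
  "baskakov_term \<rho> n f x k =
     (f \<circ> inv_into {0..} \<rho>) (real k / real n) * real ((n + k - 1) choose k)
       * (\<rho> x ^ k / (1 + \<rho> x) ^ (n + k))"

definition baskakov :: "(real \<Rightarrow> real) \<Rightarrow> nat \<Rightarrow> (real \<Rightarrow> real) \<Rightarrow> real \<Rightarrow> real" where
  "baskakov \<rho> n f x = (\<Sum>k. baskakov_term \<rho> n f x k)"

definition weight :: "(real \<Rightarrow> real) \<Rightarrow> real \<Rightarrow> real" where
  "weight \<rho> x = 1 + (\<rho> x)\<^sup>2"

definition B_space :: "(real \<Rightarrow> real) \<Rightarrow> (real \<Rightarrow> real) set" where
  "B_space \<phi> = {f. \<exists>M. \<forall>x\<in>{0..}. \<bar>f x\<bar> \<le> M * \<phi> x}"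

definition C_space :: "(real \<Rightarrow> real) \<Rightarrow> (real \<Rightarrow> real) set" where
  "C_space \<phi> = {f \<in> B_space \<phi>. continuous_on {0..} f}"

text \<open>The suprema are taken in the extended reals, so that they are meaningful without a
  boundedness proof; a finite bound on the norm includes the boundedness of the quotient.\<close>

definition weighted_norm :: "(real \<Rightarrow> real) \<Rightarrow> (real \<Rightarrow> real) \<Rightarrow> ereal" where
  "weighted_norm w g = (SUP x\<in>{0..}. ereal (\<bar>g x\<bar> / w x))"

definition weighted_modulus :: "(real \<Rightarrow> real) \<Rightarrow> (real \<Rightarrow> real) \<Rightarrow> real \<Rightarrow> ereal" where
  "weighted_modulus \<rho> f \<delta> =
     (SUP (x, t)\<in>{(x, t). x \<in> {0..} \<and> t \<in> {0..} \<and> \<bar>\<rho> x - \<rho> t\<bar> \<le> \<delta>}.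
        ereal (\<bar>f t - f x\<bar> / (weight \<rho> t + weight \<rho> x)))"

text \<open>Well-definedness: \<open>\<rho>\<close> is a bijection of the half-line, so \<open>inv_into {0..} \<rho>\<close> is its inverse
  there; the series converges for every function of the space; and the modulus is finite.\<close>

lemma admissible_bij_betw:
  assumes "admissible \<rho>"
  shows "bij_betw \<rho> {0..} {0..}"
proof -
  from assms obtain \<rho>' where r0: "\<rho> 0 = 0"
    and d: "\<And>x. x \<ge> 0 \<Longrightarrow> (\<rho> has_real_derivative \<rho>' x) (at x within {0..})"
    and i: "(INF x\<in>{0..}. ereal (\<rho>' x)) \<ge> 1"
    unfolding admissible_def by auto
  have d1: "\<rho>' x \<ge> 1" if "x \<ge> 0" for x
    using i that by (auto simp: le_INF_iff one_ereal_def)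
  have cont: "continuous_on {0..} \<rho>"
    by (rule DERIV_continuous_on[of "{0..}" \<rho> \<rho>']) (use d in auto)
  have growth: "\<rho> y - \<rho> x \<ge> y - x" if "0 \<le> x" "x < y" for x y
  proof -
    have "\<exists>z>x. z < y \<and> \<rho> y - \<rho> x = \<rho>' z * (y - x)"
    proof (rule mvt[OF \<open>x < y\<close>, of \<rho> "\<lambda>z h. \<rho>' z * h"])
      show "continuous_on {x..y} \<rho>"
        by (rule continuous_on_subset[OF cont]) (use that in auto)
    next
      fix z assume z: "x < z" "z < y"
      have "at z within {0..} = at z"
        by (rule at_within_interior) (use z that in \<open>auto simp: interior_real_atLeast\<close>)
      with d[of z] z that show "(\<rho> has_derivative (\<lambda>h. \<rho>' z * h)) (at z)"
        by (auto simp: has_field_derivative_def)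
    qed auto
    then obtain z where z: "z > x" "\<rho> y - \<rho> x = \<rho>' z * (y - x)" by blast
    have "1 * (y - x) \<le> \<rho>' z * (y - x)"
      using d1[of z] z that by (intro mult_right_mono) auto
    with z show ?thesis by simp
  qed
  have inj: "inj_on \<rho> {0..}"
  proof (rule linorder_inj_onI)
    fix x y :: real assume "x < y" "x \<in> {0..}" "y \<in> {0..}"
    with growth[of x y] show "\<rho> x \<noteq> \<rho> y" by auto
  qed auto
  have ge: "\<rho> x \<ge> x" if "x \<ge> 0" for x
    using growth[of 0 x] that r0 by (cases "x = 0") auto
  have "\<rho> ` {0..} = {0..}"
  proof (intro equalityI subsetI)
    fix y assume "y \<in> \<rho> ` {0..}"
    then show "y \<in> {0..}" using ge by force
  next
    fix y :: real assume y: "y \<in> {0..}"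
    have "\<exists>x\<ge>0. x \<le> y \<and> \<rho> x = y"
      by (rule IVT') (use y r0 ge[of y] in \<open>auto intro: continuous_on_subset[OF cont]\<close>)
    then show "y \<in> \<rho> ` {0..}" by force
  qed
  with inj show ?thesis by (auto simp: bij_betw_def)
qed

lemma summable_baskakov_term:
  assumes \<rho>: "admissible \<rho>" and f: "f \<in> C_space (weight \<rho>)" and n: "n \<ge> 1" and x: "x \<ge> 0"
  shows "summable (baskakov_term \<rho> n f x)"
proof -
  note bij = admissible_bij_betw[OF \<rho>]
  obtain M where M: "\<And>x. x \<ge> 0 \<Longrightarrow> \<bar>f x\<bar> \<le> M * weight \<rho> x"
    using f by (auto simp: C_space_def B_space_def)
  define y where "y = \<rho> x"
  have y: "y \<ge> 0" using bij x by (auto simp: y_def bij_betw_def)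
  define q where "q = y / (1 + y)"
  have q: "0 \<le> q" "q < 1" using y by (auto simp: q_def)
  define g where "g k = (1 + (real k / real n)\<^sup>2) * real ((n + k - 1) choose k) * q ^ k" for k
  have "summable g"
  proof (cases "q = 0")
    case True
    have "\<And>k. k \<notin> {0} \<Longrightarrow> g k = 0" by (simp add: g_def True)
    then show ?thesis by (intro summable_finite[of "{0}"]) auto
  next
    case False
    with q have q0: "q > 0" by simp
    have binpos: "real ((n + k - 1) choose k) > 0" for k using n by (simp add: zero_less_binomial)
    have binrec: "real (Suc k) * real ((n + Suc k - 1) choose Suc k)
        = (real n + real k) * real ((n + k - 1) choose k)" for k
    proof -
      obtain m where m: "n = Suc m" using n by (cases n) auto
      have "Suc k * (Suc (m + k) choose Suc k) = Suc (m + k) * ((m + k) choose k)"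
        by (rule Suc_times_binomial)
      from arg_cong[OF this, of real] show ?thesis
        unfolding of_nat_mult by (simp add: m add_ac)
    qed
    have gpos: "g k > 0" for k
      unfolding g_def using q0 binpos[of k] by (intro mult_pos_pos add_pos_nonneg) auto
    have ratio: "g k / g (Suc k) = (1 + (real k / real n)\<^sup>2) / (1 + ((real k + 1) / real n)\<^sup>2)
        * ((real k + 1) / (real n + real k)) / q" for k
    proof -
      define b where "b = real ((n + k - 1) choose k)"
      have b: "b > 0" using binpos by (simp add: b_def)
      define c where "c = 1 + (real k / real n)\<^sup>2"
      define d where "d = 1 + ((real k + 1) / real n)\<^sup>2"
      have cd: "c > 0" "d > 0" by (auto simp: c_def d_def add_pos_nonneg)
      have bb: "real ((n + Suc k - 1) choose Suc k) = (real n + real k) * b / (real k + 1)"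
        using binrec[of k] by (simp add: b_def field_simps)
      have nk: "real n + real k > 0" using n by simp
      have "g k / g (Suc k) = (c * b * q ^ k) / (d * ((real n + real k) * b / (real k + 1)) * q ^ Suc k)"
        unfolding g_def bb b_def[symmetric] c_def[symmetric] by (simp add: d_def add_ac)
      also have "\<dots> = c / d * ((real k + 1) / (real n + real k)) / q"
      proof -
        have alg: "c * b * p / (d * (N * b / K) * (q * p)) = c / d * (K / N) / q"
          if "p > 0" "N > 0" "K > 0" for p N K :: real
          using that b cd q0 by (simp add: field_simps)
        show ?thesis using alg[of "q ^ k" "real n + real k" "real k + 1"] nk q0 by simp
      qed
      finally show ?thesis by (simp add: c_def d_def)
    qed
    define a where "a = real n"
    have a: "a > 0" using n by (simp add: a_def)
    have eq: "(1 + (real k / a)\<^sup>2) / (1 + ((real k + 1) / a)\<^sup>2)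
        = (a\<^sup>2 + (real k)\<^sup>2) / (a\<^sup>2 + (real k + 1)\<^sup>2)" for k
    proof -
      have "1 + (u / a)\<^sup>2 = (a\<^sup>2 + u\<^sup>2) / a\<^sup>2" for u
        using a by (simp add: power_divide add_divide_distrib)
      then show ?thesis using a by (simp only: divide_divide_eq_left divide_divide_eq_right) simp
    qed
    have lim: "(\<lambda>k. (a\<^sup>2 + (real k)\<^sup>2) / (a\<^sup>2 + (real k + 1)\<^sup>2)
        * ((real k + 1) / (a + real k))) \<longlonglongrightarrow> 1"
      using a by real_asymp
    have "(\<lambda>k. (1 + (real k / a)\<^sup>2) / (1 + ((real k + 1) / a)\<^sup>2)
        * ((real k + 1) / (a + real k)) / q) \<longlonglongrightarrow> 1 / q"
      unfolding eq by (rule tendsto_divide[OF lim tendsto_const]) (use q0 in simp)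
    then have "(\<lambda>k. g k / g (Suc k)) \<longlonglongrightarrow> 1 / q"
      by (simp add: ratio a_def)
    then have "(\<lambda>k. ereal (g k / g (Suc k))) \<longlonglongrightarrow> ereal (1 / q)"
      by simp
    then have "liminf (\<lambda>k. ereal (g k / g (Suc k))) = ereal (1 / q)"
      by (rule lim_imp_Liminf[OF sequentially_bot])
    moreover have "1 / q > 1" using q q0 by simp
    ultimately show ?thesis
      using gpos by (intro ratio_test_convergence) (auto simp: one_ereal_def)
  qed
  then have "summable (\<lambda>k. M / (1 + y) ^ n * g k)" by (rule summable_mult)
  moreover have "norm (baskakov_term \<rho> n f x k) \<le> M / (1 + y) ^ n * g k" for k
  proof -
    have img: "real k / real n \<in> \<rho> ` {0..}" using bij by (auto simp: bij_betw_def)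
    have "\<bar>f (inv_into {0..} \<rho> (real k / real n))\<bar> \<le> M * (1 + (real k / real n)\<^sup>2)"
      using M[of "inv_into {0..} \<rho> (real k / real n)"] inv_into_into[OF img] f_inv_into_f[OF img]
      by (simp add: weight_def)
    then have "\<bar>f (inv_into {0..} \<rho> (real k / real n))\<bar>
        * (real ((n + k - 1) choose k) * (y ^ k / (1 + y) ^ (n + k)))
      \<le> M * (1 + (real k / real n)\<^sup>2) * (real ((n + k - 1) choose k) * (y ^ k / (1 + y) ^ (n + k)))"
      using y by (intro mult_right_mono) auto
    then show ?thesis
      using y by (simp add: baskakov_term_def y_def[symmetric] abs_mult g_def q_def power_add
        power_divide mult_ac)
  qed
  ultimately show ?thesis
    by (rule summable_comparison_test')
qed

lemma weighted_modulus_finite: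
  assumes f: "f \<in> C_space (weight \<rho>)" and \<delta>: "\<delta> > 0"
  shows "\<bar>weighted_modulus \<rho> f \<delta>\<bar> \<noteq> \<infinity>"
proof -
  obtain M where M: "\<And>x. x \<ge> 0 \<Longrightarrow> \<bar>f x\<bar> \<le> M * weight \<rho> x"
    using f by (auto simp: C_space_def B_space_def)
  have w: "weight \<rho> x > 0" for x by (simp add: weight_def add_pos_nonneg)
  have bound: "\<bar>f t - f x\<bar> / (weight \<rho> t + weight \<rho> x) \<le> M" if "x \<ge> 0" "t \<ge> 0" for x t
  proof -
    have "\<bar>f t - f x\<bar> \<le> M * (weight \<rho> t + weight \<rho> x)"
      using M[OF that(1)] M[OF that(2)] by (simp add: algebra_simps)
    then show ?thesis using w[of t] w[of x] by (simp add: divide_le_eq add_pos_pos)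
  qed
  have "weighted_modulus \<rho> f \<delta> \<le> ereal M"
    unfolding weighted_modulus_def by (rule SUP_least) (use bound in auto)
  moreover have "0 \<le> weighted_modulus \<rho> f \<delta>"
    unfolding weighted_modulus_def by (rule SUP_upper2[of "(0, 0)"]) (use \<delta> in auto)
  ultimately show ?thesis by auto
qed

end

theory Submission
  imports Defs
begin

text \<open>In the variable \<open>u = \<rho> t\<close> the weight is the convex function \<open>1 + u\<^sup>2\<close>. Cutting the segment from
  \<open>\<rho> x\<close> to \<open>\<rho> t\<close> into equal pieces of length at most \<open>\<delta>\<close> and using convexity gives
  \<open>\<bar>f t - f x\<bar> \<le> (1 + \<bar>\<rho> t - \<rho> x\<bar> / \<delta>) (\<phi> t + \<phi> x) \<omega>(f; \<delta>)\<close>. This is averaged against the negative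
  binomial weights. With \<open>y = \<rho> x\<close> and \<open>d = k / n - y\<close>, the factor \<open>\<bar>d\<bar>\<close> is dominated by the quadratic
  \<open>(d\<^sup>2 / \<epsilon> + \<epsilon>) / 2\<close> with \<open>\<epsilon>\<^sup>2 = 2 (1 + y\<^sup>2) / n\<close>, and \<open>d\<^sup>2 \<bar>d\<bar>\<close> by \<open>d\<^sup>2 (2 y + d)\<close>, so only the central
  moments up to order 3 are needed.\<close>

section \<open>From a local to a global estimate by subdividing a segment\<close>

text \<open>Telescope over \<open>m\<close> equal pieces of the segment from \<open>a\<close> to
  \<open>b\<close>. At each node convexity replaces \<open>\<phi>\<close> by its linear
  interpolation, so only the endpoint values remain and nothing inside the segment has to be
  estimated.\<close>

lemma diff_bound_subdivision:
  fixes g :: "'a::real_normed_vector \<Rightarrow> real"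
  assumes conv: "convex_on S \<phi>"
    and near: "\<And>a b. a \<in> S \<Longrightarrow> b \<in> S \<Longrightarrow> dist a b \<le> \<delta> \<Longrightarrow> \<bar>g b - g a\<bar> \<le> W * (\<phi> a + \<phi> b)"
    and W: "W \<ge> 0" and a: "a \<in> S" and b: "b \<in> S"
    and m: "m > 0" "dist a b \<le> real m * \<delta>"
  shows "\<bar>g b - g a\<bar> \<le> real m * (W * (\<phi> a + \<phi> b))"
proof -
  define p where "p i = (1 - real i / real m) *\<^sub>R a + (real i / real m) *\<^sub>R b" for i
  have pS: "p i \<in> S" if "i \<le> m" for i
    unfolding p_def using convex_on_imp_convex[OF conv] a b that m
    by (intro convexD) auto
  have \<phi>p: "\<phi> (p i) \<le> (1 - real i / real m) * \<phi> a + (real i / real m) * \<phi> b" if "i \<le> m" for i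
    unfolding p_def using that m by (intro convex_onD[OF conv] a b) auto
  have step: "\<bar>g (p (Suc i)) - g (p i)\<bar>
      \<le> W * ((2 - (2 * real i + 1) / real m) * \<phi> a + (2 * real i + 1) / real m * \<phi> b)"
    if "i < m" for i
  proof -
    have "p (Suc i) - p i = (1 / real m) *\<^sub>R (b - a)"
      by (simp add: p_def algebra_simps add_divide_distrib)
    then have "norm (p (Suc i) - p i) = norm (b - a) / real m" by simp
    then have "dist (p i) (p (Suc i)) = dist a b / real m"
      by (simp only: dist_norm norm_minus_commute[of a] norm_minus_commute[of "p i"])
    also have "\<dots> \<le> \<delta>" using m by (simp add: divide_le_eq mult.commute)
    finally have "\<bar>g (p (Suc i)) - g (p i)\<bar> \<le> W * (\<phi> (p i) + \<phi> (p (Suc i)))"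
      using that by (intro near pS) auto
    also have "\<dots> \<le> W * (((1 - real i / real m) * \<phi> a + (real i / real m) * \<phi> b)
        + ((1 - real (Suc i) / real m) * \<phi> a + (real (Suc i) / real m) * \<phi> b))"
      using that by (intro mult_left_mono add_mono \<phi>p W) auto
    finally show ?thesis by (simp add: algebra_simps add_divide_distrib)
  qed
  \<comment> \<open>The nodes \<open>i\<close> and \<open>i + 1\<close> together give
    \<open>\<phi> b\<close> the coefficient \<open>(2 * i + 1) / m\<close>. These sum to
    \<open>m\<close>, and the complementary coefficients of \<open>\<phi> a\<close> sum to
    \<open>2 * m - m\<close>, hence the symmetric total.\<close>
  have odd_sum: "(\<Sum>i<m. 2 * real i + 1) = (real m)\<^sup>2" for m
    by (induction m) (auto simp: power2_eq_square algebra_simps)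
  have "g b - g a = (\<Sum>i<m. g (p (Suc i)) - g (p i))"
    using m sum_lessThan_telescope[of "\<lambda>i. g (p i)" m] by (simp add: p_def)
  also have "\<bar>\<dots>\<bar> \<le> (\<Sum>i<m. \<bar>g (p (Suc i)) - g (p i)\<bar>)" by (rule sum_abs)
  also have "\<dots> \<le> (\<Sum>i<m. W * ((2 - (2 * real i + 1) / real m) * \<phi> a
      + (2 * real i + 1) / real m * \<phi> b))"
    by (intro sum_mono step) auto
  also have "\<dots> = W * ((2 * real m - (\<Sum>i<m. 2 * real i + 1) / real m) * \<phi> a
      + (\<Sum>i<m. 2 * real i + 1) / real m * \<phi> b)"
    by (simp only: sum_distrib_left[symmetric] sum.distrib sum_distrib_right[symmetric]
        sum_subtractf sum_divide_distrib[symmetric]) simp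
  also have "\<dots> = real m * (W * (\<phi> a + \<phi> b))"
    unfolding odd_sum using m by (simp add: power2_eq_square algebra_simps)
  finally show ?thesis .
qed

text \<open>The least number of pieces of length at most \<open>\<delta>\<close> is the ceiling of
  \<open>dist a b / \<delta>\<close>, which exceeds that quotient by at most 1. Coincident points
  are treated apart, since there the ceiling is 0 and no subdivision exists.\<close>

lemma diff_bound_of_local_bound:
  fixes g :: "'a::real_normed_vector \<Rightarrow> real"
  assumes "convex_on S \<phi>"
    and "\<And>a b. a \<in> S \<Longrightarrow> b \<in> S \<Longrightarrow> dist a b \<le> \<delta> \<Longrightarrow> \<bar>g b - g a\<bar> \<le> W * (\<phi> a + \<phi> b)"
    and W: "W \<ge> 0" and \<phi>: "\<phi> a + \<phi> b \<ge> 0" and \<delta>: "\<delta> > 0" and "a \<in> S" "b \<in> S"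
  shows "\<bar>g b - g a\<bar> \<le> (1 + dist a b / \<delta>) * (W * (\<phi> a + \<phi> b))"
proof (cases "a = b")
  case True
  with W \<phi> show ?thesis by simp
next
  case False
  define m where "m = nat \<lceil>dist a b / \<delta>\<rceil>"
  have pos: "dist a b / \<delta> > 0" using False \<delta> by simp
  have m: "m > 0" "dist a b / \<delta> \<le> real m" "real m \<le> 1 + dist a b / \<delta>"
    using pos unfolding m_def by linarith+
  have "\<bar>g b - g a\<bar> \<le> real m * (W * (\<phi> a + \<phi> b))"
    using m \<delta> by (intro diff_bound_subdivision[OF assms(1,2) W]) (auto simp: field_simps assms)
  also have "\<dots> \<le> (1 + dist a b / \<delta>) * (W * (\<phi> a + \<phi> b))"
    by (intro mult_right_mono m mult_nonneg_nonneg W \<phi>)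
  finally show ?thesis .
qed

section \<open>Negative binomial weights and their moments\<close>

text \<open>For \<open>n \<ge> 1\<close> and \<open>y \<ge> 0\<close>, the probability of
  \<open>k\<close> failures before the \<open>n\<close>-th success when the success probability is
  \<open>1 / (1 + y)\<close>. The mean of \<open>k\<close> is \<open>n * y\<close>, so the nodes
  \<open>k / n\<close> are centred at \<open>y\<close>.\<close>

definition negbin_weight :: "nat \<Rightarrow> real \<Rightarrow> nat \<Rightarrow> real" where
  "negbin_weight n y k = real ((n + k - 1) choose k) * (y ^ k / (1 + y) ^ (n + k))"

lemma negbin_weight_nonneg: "y \<ge> 0 \<Longrightarrow> negbin_weight n y k \<ge> 0"
  by (simp add: negbin_weight_def)

text \<open>This is Newton's binomial series for exponent \<open>- n\<close> at \<open>- q\<close>,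
  where \<open>q = y / (1 + y) < 1\<close> and \<open>1 - q = 1 / (1 + y)\<close>.\<close>

lemma negbin_weight_sums:
  assumes n: "n \<ge> 1" and y: "y \<ge> 0"
  shows "negbin_weight n y sums 1"
proof -
  define q where "q = y / (1 + y)"
  have q: "\<bar>- q\<bar> < 1" and q1: "1 + (- q) = 1 / (1 + y)" using y by (auto simp: q_def field_simps)
  have "(\<lambda>k. (- real n gchoose k) * (- q) ^ k) sums (1 + (- q)) powr (- real n)"
    by (rule gen_binomial_real[OF q])
  moreover have "(1 + (- q)) powr (- real n) = (1 + y) ^ n"
    unfolding q1 using y by (simp add: powr_minus powr_realpow power_one_over field_simps)
  \<comment> \<open>Negating the upper index produces \<open>(- 1) ^ k\<close>, which cancels the
    sign of \<open>(- q) ^ k\<close>.\<close>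
  moreover have "(- real n gchoose k) * (- q) ^ k = real ((n + k - 1) choose k) * q ^ k" for k
  proof -
    have "real n + real k - 1 = real (n + k - 1)" using n by simp
    then have "(- real n gchoose k) = (- 1) ^ k * real ((n + k - 1) choose k)"
      by (simp only: gbinomial_minus binomial_gbinomial)
    moreover have "(- q) ^ k = (- 1) ^ k * q ^ k"
      by (rule power_minus)
    ultimately show ?thesis by (simp add: power_mult_distrib[symmetric])
  qed
  ultimately have "(\<lambda>k. real ((n + k - 1) choose k) * q ^ k) sums (1 + y) ^ n" by simp
  from sums_divide[OF this, of "(1 + y) ^ n"] show ?thesis
    using y by (simp add: negbin_weight_def[abs_def] q_def power_add power_divide mult_ac)
qed

text \<open>Two absorption identities for binomial coefficients trade a factor \<open>k\<close> for
  a step from \<open>n\<close> to \<open>n + 1\<close>; the denominator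
  \<open>(1 + y) ^ (n + k + 1)\<close> is the same on both sides.\<close>

lemma negbin_weight_Suc:
  assumes n: "n \<ge> 1"
  shows "real (Suc k) * negbin_weight n y (Suc k) = real n * y * negbin_weight (Suc n) y k"
proof -
  obtain m where m: "n = Suc m" using n by (cases n) auto
  have "Suc k * (Suc (m + k) choose Suc k) = Suc (m + k) * ((m + k) choose k)"
    by (rule Suc_times_binomial)
  also have "\<dots> = Suc m * (Suc (m + k) choose k)"
    using binomial_absorb_comp[of "Suc (m + k)" k] by simp
  finally have "real (Suc k) * real (Suc (m + k) choose Suc k)
      = real (Suc m) * real (Suc (m + k) choose k)"
    by (metis of_nat_mult)
  then have "real (Suc k) * real (Suc (m + k) choose Suc k) * (y * y ^ k / (1 + y) ^ (n + Suc k))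
      = real (Suc m) * real (Suc (m + k) choose k) * (y * y ^ k / (1 + y) ^ (n + Suc k))"
    by (rule arg_cong)
  then show ?thesis
    by (simp only: negbin_weight_def m) (simp add: mult_ac)
qed

text \<open>Recursion for moments: a mean with a factor \<open>k\<close> for parameter
  \<open>n\<close> becomes a shifted mean for \<open>n + 1\<close>. The term at index 0 vanishes, so
  the shift of the series loses nothing.\<close>

lemma negbin_weight_times_sums:
  assumes n: "n \<ge> 1" and s: "(\<lambda>k. h (Suc k) * negbin_weight (Suc n) y k) sums s"
  shows "(\<lambda>k. real k * h k * negbin_weight n y k) sums (real n * y * s)"
proof -
  have "(\<lambda>k. real (Suc k) * h (Suc k) * negbin_weight n y (Suc k))
      = (\<lambda>k. real n * y * (h (Suc k) * negbin_weight (Suc n) y k))"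
    using negbin_weight_Suc[OF n, of _ y] by (simp add: fun_eq_iff mult_ac)
  then have "(\<lambda>k. real (Suc k) * h (Suc k) * negbin_weight n y (Suc k)) sums (real n * y * s)"
    using sums_mult[OF s, of "real n * y"] by simp
  then show ?thesis
    using sums_Suc_iff[of "\<lambda>k. real k * h k * negbin_weight n y k"] by simp
qed

lemma negbin_weight_moments:
  assumes n: "n \<ge> 1" and y: "y \<ge> 0"
  shows "(\<lambda>k. real k * negbin_weight n y k) sums (real n * y)"
    and "(\<lambda>k. (real k)\<^sup>2 * negbin_weight n y k) sums (real n * y * ((real n + 1) * y + 1))"
    and "(\<lambda>k. (real k)^3 * negbin_weight n y k) sums
          (real n * y * ((real n + 1) * y * ((real n + 2) * y + 1) + 2 * ((real n + 1) * y) + 1))"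
proof -
  note one = negbin_weight_sums[OF _ y]
  \<comment> \<open>Stated for every \<open>n\<close>, because each moment for \<open>n\<close> is
    computed from lower moments for \<open>n + 1\<close>.\<close>
  have first: "(\<lambda>k. real k * negbin_weight n y k) sums (real n * y)" if "n \<ge> 1" for n
    using negbin_weight_times_sums[OF that, of "\<lambda>_. 1" y 1] one[of "Suc n"] by simp
  have second: "(\<lambda>k. (real k)\<^sup>2 * negbin_weight n y k) sums (real n * y * ((real n + 1) * y + 1))"
    if "n \<ge> 1" for n
  proof -
    have "(\<lambda>k. real (Suc k) * negbin_weight (Suc n) y k) sums (real (Suc n) * y + 1)"
      using sums_add[OF first[of "Suc n"] one[of "Suc n"]] by (simp add: algebra_simps)
    from negbin_weight_times_sums[OF that this] show ?thesis
      by (simp add: power2_eq_square add_ac)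
  qed
  have "(\<lambda>k. (real (Suc k))\<^sup>2 * negbin_weight (Suc n) y k) sums
      (real (Suc n) * y * ((real (Suc n) + 1) * y + 1) + 2 * (real (Suc n) * y) + 1)"
    using sums_add[OF sums_add[OF second[of "Suc n"] sums_mult[OF first[of "Suc n"], of 2]]
        one[of "Suc n"]]
    by (simp add: algebra_simps power2_eq_square)
  from negbin_weight_times_sums[OF n this]
  show "(\<lambda>k. (real k)^3 * negbin_weight n y k) sums
      (real n * y * ((real n + 1) * y * ((real n + 2) * y + 1) + 2 * ((real n + 1) * y) + 1))"
    by (simp add: power3_eq_cube power2_eq_square mult.assoc add_ac)
  show "(\<lambda>k. real k * negbin_weight n y k) sums (real n * y)"
    and "(\<lambda>k. (real k)\<^sup>2 * negbin_weight n y k) sums (real n * y * ((real n + 1) * y + 1))"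
    using first second n by auto
qed

text \<open>Contains the central moments of \<open>k / n\<close> up to order 3. The coefficient
  \<open>c1\<close> disappears from the sum because \<open>d\<close> has mean 0.\<close>

lemma negbin_weight_cubic_sums:
  assumes n: "n \<ge> 1" and y: "y \<ge> 0"
  defines "d \<equiv> \<lambda>k. real k / real n - y"
  shows "(\<lambda>k. (c0 + c1 * d k + c2 * (d k)\<^sup>2 + c3 * d k ^ 3) * negbin_weight n y k) sums
    (c0 + c2 * (y * (1 + y) / real n) + c3 * (y * (1 + y) * (1 + 2 * y) / (real n)\<^sup>2))"
proof -
  define N where "N = real n"
  have N: "N > 0" using n by (simp add: N_def)
  \<comment> \<open>\<open>e0\<close> to \<open>e3\<close> are the coefficients of the same cubic,
    rearranged by powers of \<open>k\<close>, so that the raw moments apply.\<close>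
  define e0 where "e0 = c0 - c1 * y + c2 * y\<^sup>2 - c3 * y^3"
  define e1 where "e1 = (c1 - 2 * c2 * y + 3 * c3 * y\<^sup>2) / N"
  define e2 where "e2 = (c2 - 3 * c3 * y) / N\<^sup>2"
  define e3 where "e3 = c3 / N^3"
  have "(\<lambda>k. e0 * negbin_weight n y k + e1 * (real k * negbin_weight n y k)
      + e2 * ((real k)\<^sup>2 * negbin_weight n y k) + e3 * ((real k)^3 * negbin_weight n y k)) sums
      (e0 * 1 + e1 * (N * y) + e2 * (N * y * ((N + 1) * y + 1))
      + e3 * (N * y * ((N + 1) * y * ((N + 2) * y + 1) + 2 * ((N + 1) * y) + 1)))"
    unfolding N_def
    by (intro sums_add sums_mult negbin_weight_sums negbin_weight_moments n y)
  moreover have "e0 * b + e1 * (k * b) + e2 * (k\<^sup>2 * b) + e3 * (k^3 * b)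
      = (c0 + c1 * (k / N - y) + c2 * (k / N - y)\<^sup>2 + c3 * (k / N - y)^3) * b" for k b
    using N unfolding e0_def e1_def e2_def e3_def
    by (simp add: field_simps power2_eq_square power3_eq_cube)
  moreover have "e0 * 1 + e1 * (N * y) + e2 * (N * y * ((N + 1) * y + 1))
      + e3 * (N * y * ((N + 1) * y * ((N + 2) * y + 1) + 2 * ((N + 1) * y) + 1))
      = c0 + c2 * (y * (1 + y) / N) + c3 * (y * (1 + y) * (1 + 2 * y) / N\<^sup>2)"
    using N unfolding e0_def e1_def e2_def e3_def
    by (simp add: field_simps power2_eq_square power3_eq_cube)
  ultimately show ?thesis by (simp add: d_def N_def)
qed

section \<open>A cubic majorant and the estimate of its mean\<close>

text \<open>Absolute values are traded for a polynomial in \<open>d\<close>, whose mean is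
  computable exactly. The parameter \<open>\<epsilon>\<close> stays free here and is tuned to the
  variance later.\<close>

lemma weighted_dist_le_cubic:
  fixes y d \<epsilon> \<delta> :: real
  assumes "y \<ge> 0" "y + d \<ge> 0" "\<epsilon> > 0" "\<delta> > 0"
  defines "w \<equiv> 1 + y\<^sup>2"
  shows "(1 + \<bar>d\<bar> / \<delta>) * (w + (1 + (y + d)\<^sup>2))
    \<le> 2 * w + 2 * y * d + d\<^sup>2 + (w * \<epsilon> + (w / \<epsilon> + 4 * y) * d\<^sup>2 + d^3) / \<delta>"
proof -
  have w: "w + (1 + (y + d)\<^sup>2) = 2 * w + 2 * y * d + d\<^sup>2"
    by (simp add: w_def power2_eq_square algebra_simps)
  have "0 \<le> (\<bar>d\<bar> - \<epsilon>)\<^sup>2" by simp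
  then have "2 * \<bar>d\<bar> * \<epsilon> \<le> d\<^sup>2 + \<epsilon>\<^sup>2" by (simp add: power2_diff)
  then have "2 * \<bar>d\<bar> \<le> \<epsilon> + d\<^sup>2 / \<epsilon>" using assms by (simp add: field_simps power2_eq_square)
  then have "w * (2 * \<bar>d\<bar>) \<le> w * (\<epsilon> + d\<^sup>2 / \<epsilon>)"
    by (intro mult_left_mono) (auto simp: w_def)
  moreover have "2 * y * (d * \<bar>d\<bar>) \<le> 2 * y * d\<^sup>2"
    using assms by (intro mult_left_mono) (auto simp: power2_eq_square abs_if mult_nonneg_nonneg)
  \<comment> \<open>For negative \<open>d\<close> this is where \<open>d \<ge> - y\<close> enters:
    it gives \<open>- d \<le> 2 * y + d\<close>.\<close>
  moreover have "d\<^sup>2 * \<bar>d\<bar> \<le> d\<^sup>2 * (2 * y + d)"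
    using assms by (intro mult_left_mono) auto
  ultimately have "\<bar>d\<bar> * (2 * w + 2 * y * d + d\<^sup>2) \<le> w * \<epsilon> + (w / \<epsilon> + 4 * y) * d\<^sup>2 + d^3"
    by (simp add: algebra_simps power2_eq_square power3_eq_cube)
  then have "\<bar>d\<bar> * (2 * w + 2 * y * d + d\<^sup>2) / \<delta> \<le> (w * \<epsilon> + (w / \<epsilon> + 4 * y) * d\<^sup>2 + d^3) / \<delta>"
    using assms by (intro divide_right_mono) auto
  then show ?thesis unfolding w by (simp add: algebra_simps add_divide_distrib)
qed

text \<open>Since \<open>\<epsilon>\<^sup>2 = 2 * w / n\<close> bounds the variance
  \<open>y * (1 + y) / n\<close>, both terms with \<open>\<epsilon>\<close> are at most
  \<open>w * \<epsilon>\<close>. Their sum matches the \<open>1 / sqrt n\<close> part of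
  \<open>\<delta>\<close> times \<open>w powr (3/2)\<close>, and the \<open>16 / n\<close> part
  absorbs the rest.\<close>

lemma cubic_mean_le:
  fixes y :: real and n :: nat
  assumes y: "y \<ge> 0" and n: "n \<ge> 1"
  defines "w \<equiv> 1 + y\<^sup>2" and "\<delta> \<equiv> 2 * sqrt 2 / sqrt (real n) + 16 / real n"
  defines "\<epsilon> \<equiv> sqrt (2 * w / real n)"
  shows "2 * w + w * \<epsilon> / \<delta> + (1 + (w / \<epsilon> + 4 * y) / \<delta>) * (y * (1 + y) / real n)
      + 1 / \<delta> * (y * (1 + y) * (1 + 2 * y) / (real n)\<^sup>2)
    \<le> (7 + 4 / real n) * w powr (3/2)"
proof -
  define N where "N = real n"
  have N: "N \<ge> 1" using n by (simp add: N_def)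
  \<comment> \<open>\<open>w * s\<close> is the target \<open>w powr (3/2)\<close>, and
    \<open>s\<close> dominates both 1 and \<open>y\<close>.\<close>
  define s where "s = sqrt w"
  have w1: "w \<ge> 1" by (simp add: w_def)
  have s: "s \<ge> 1" "s\<^sup>2 = w" "s * s = w" using w1 by (auto simp: s_def)
  have ws: "w powr (3/2) = w * s"
  proof -
    have "w powr (3/2) = w powr (1 + 1/2)" by simp
    also have "\<dots> = w * s" unfolding powr_add s_def using w1 by (simp add: powr_half_sqrt)
    finally show ?thesis .
  qed
  have ys: "y \<le> s" unfolding s_def w_def by (intro real_le_rsqrt) simp
  have \<delta>: "\<delta> > 0" using n by (simp add: \<delta>_def add_pos_pos)
  have \<epsilon>s: "\<epsilon> = sqrt 2 * s / sqrt N" by (simp add: \<epsilon>_def s_def real_sqrt_mult real_sqrt_divide N_def)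
  have \<epsilon>: "\<epsilon> > 0" "\<epsilon>\<^sup>2 = 2 * w / N" using w1 n by (auto simp: \<epsilon>_def N_def)
  define V where "V = y * (1 + y) / N"
  define T where "T = y * (1 + y) * (1 + 2 * y) / N\<^sup>2"
  have y1: "y * (1 + y) \<le> 2 * w"
  proof -
    have "0 \<le> (y - 1/2)\<^sup>2" by simp
    then show ?thesis by (simp add: w_def power2_eq_square algebra_simps)
  qed
  have V: "V \<ge> 0" "V \<le> 2 * w / N"
    using y1 y N by (auto simp: V_def divide_right_mono)
  have T: "T \<le> 6 * (w * s) / N"
  proof -
    have "y * (1 + y) * (1 + 2 * y) \<le> (2 * w) * (3 * s)"
      by (rule mult_mono) (use y1 y ys s w1 in auto)
    then have "T \<le> (6 * (w * s)) / N\<^sup>2"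
      unfolding T_def by (intro divide_right_mono) auto
    also have "\<dots> \<le> 6 * (w * s) / N"
      using N w1 s by (intro divide_left_mono) (auto simp: power2_eq_square)
    finally show ?thesis .
  qed
  have "w / \<epsilon> * V \<le> w / \<epsilon> * \<epsilon>\<^sup>2"
    using V \<epsilon> w1 by (intro mult_left_mono) auto
  then have a: "w / \<epsilon> * V \<le> w * \<epsilon>" using \<epsilon>(1) by (simp add: power2_eq_square)
  have b: "4 * y * V \<le> 8 * (w * s) / N"
  proof -
    have "4 * y * V \<le> 4 * s * (2 * w / N)"
      using V y ys s by (intro mult_mono) auto
    then show ?thesis by (simp add: mult_ac)
  qed
  have "w * \<epsilon> + (w / \<epsilon> * V + 4 * y * V) + T \<le> w * \<epsilon> + (w * \<epsilon> + 8 * (w * s) / N) + 6 * (w * s) / N"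
    using a b T by linarith
  also have "\<dots> = w * s * (2 * sqrt 2 / sqrt N + 14 / N)"
    unfolding \<epsilon>s by (simp add: algebra_simps add_divide_distrib)
  \<comment> \<open>The 14 collects 8 from the mixed term \<open>4 * y * V\<close> and 6 from the
    third moment; \<open>\<delta>\<close> offers 16.\<close>
  also have "\<dots> \<le> w * s * \<delta>"
    unfolding \<delta>_def N_def[symmetric] using w1 s N
    by (intro mult_left_mono add_mono divide_right_mono) auto
  finally have "(w * \<epsilon> + (w / \<epsilon> * V + 4 * y * V) + T) / \<delta> \<le> w * s"
    using \<delta> by (simp add: divide_le_eq)
  moreover have "w \<le> w * s" using s w1 by simp
  moreover from this have "w / N \<le> w * s / N" using N by (intro divide_right_mono) auto
  moreover have "w * s \<ge> 0" "w * s / N \<ge> 0" using s w1 N by auto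
  moreover have "2 * w + w * \<epsilon> / \<delta> + (1 + (w / \<epsilon> + 4 * y) / \<delta>) * V + 1 / \<delta> * T
      = 2 * w + V + (w * \<epsilon> + (w / \<epsilon> * V + 4 * y * V) + T) / \<delta>"
    by (simp add: algebra_simps add_divide_distrib)
  moreover have "(7 + 4 / N) * (w * s) = 7 * (w * s) + 4 * (w * s / N)"
    by (simp add: algebra_simps)
  \<comment> \<open>The three contributions are at most \<open>2 * w * s\<close>,
    \<open>2 * w * s / N\<close> and \<open>w * s\<close>, so the constant reached is
    \<open>3 + 2 / N\<close>.\<close>
  ultimately have "2 * w + w * \<epsilon> / \<delta> + (1 + (w / \<epsilon> + 4 * y) / \<delta>) * V + 1 / \<delta> * T
      \<le> (7 + 4 / N) * (w * s)"
    using V(2) by linarith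
  then show ?thesis unfolding ws V_def T_def N_def .
qed

section \<open>Averaging the estimate over the operator\<close>

text \<open>In the variable \<open>u = \<rho> t\<close> the operator is the negative binomial mean
  of \<open>g\<close> at the nodes \<open>k / n\<close>. The weights have total 1, so the error is
  the mean of \<open>g (k / n) - g y\<close>, dominated termwise by a cubic. A real \<open>W\<close>
  stands for the modulus, which keeps the argument free of extended reals.\<close>

lemma baskakov_diff_bound:
  assumes \<rho>: "admissible \<rho>" and f: "f \<in> C_space (weight \<rho>)" and n: "n \<ge> 1" and x: "x \<ge> 0"
    and W: "W \<ge> 0" and \<delta>_def: "\<delta> = 2 * sqrt 2 / sqrt (real n) + 16 / real n"
    and near: "\<And>x t. x \<ge> 0 \<Longrightarrow> t \<ge> 0 \<Longrightarrow> \<bar>\<rho> x - \<rho> t\<bar> \<le> \<delta> \<Longrightarrow>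
      \<bar>f t - f x\<bar> \<le> W * (weight \<rho> x + weight \<rho> t)"
  shows "\<bar>baskakov \<rho> n f x - f x\<bar> \<le> (7 + 4 / real n) * weight \<rho> x powr (3/2) * W"
proof -
  define g where "g = f \<circ> inv_into {0..} \<rho>"
  define y where "y = \<rho> x"
  define w where "w = 1 + y\<^sup>2"
  define \<epsilon> where "\<epsilon> = sqrt (2 * w / real n)"
  define d where "d k = real k / real n - y" for k
  note bij = admissible_bij_betw[OF \<rho>]
  have y: "y \<ge> 0" using bij x by (auto simp: y_def bij_betw_def)
  have gx: "g y = f x" using bij x by (simp add: g_def y_def bij_betw_def)
  have inv: "inv_into {0..} \<rho> u \<ge> 0" "\<rho> (inv_into {0..} \<rho> u) = u" if "u \<ge> 0" for u
  proof -
    have u: "u \<in> \<rho> ` {0..}" using bij that by (auto simp: bij_betw_def)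
    show "inv_into {0..} \<rho> u \<ge> 0" "\<rho> (inv_into {0..} \<rho> u) = u"
      using inv_into_into[OF u] f_inv_into_f[OF u] by auto
  qed
  have \<delta>: "\<delta> > 0" using n by (simp add: \<delta>_def add_pos_pos)
  have w: "w > 0" by (simp add: w_def add_pos_nonneg)
  have \<epsilon>: "\<epsilon> > 0" using n w by (simp add: \<epsilon>_def)
  have conv: "convex_on {0..} (\<lambda>u::real. 1 + u\<^sup>2)"
    by (intro convex_on_add convex_on_subset[OF convex_power2]) (auto simp: convex_on_const)
  have g_near: "\<bar>g v - g u\<bar> \<le> W * ((1 + u\<^sup>2) + (1 + v\<^sup>2))"
    if "u \<in> {0..}" "v \<in> {0..}" "dist u v \<le> \<delta>" for u v
    using near[of "inv_into {0..} \<rho> u" "inv_into {0..} \<rho> v"] that inv[of u] inv[of v]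
    by (simp add: g_def weight_def dist_real_def)
  have g_bound: "\<bar>g u - g y\<bar> \<le> (1 + \<bar>u - y\<bar> / \<delta>) * (W * (w + (1 + u\<^sup>2)))" if "u \<ge> 0" for u
    using diff_bound_of_local_bound[OF conv g_near W _ \<delta>, of y u] that y
    by (simp add: w_def dist_real_def abs_minus_commute)
  \<comment> \<open>The cubic majorant sorted by powers of \<open>d k\<close>; \<open>S\<close> is
    its mean, where the linear coefficient \<open>2 * y\<close> drops out.\<close>
  define p where "p k = (2 * w + w * \<epsilon> / \<delta>) + 2 * y * d k
      + (1 + (w / \<epsilon> + 4 * y) / \<delta>) * (d k)\<^sup>2 + 1 / \<delta> * d k ^ 3" for k
  define S where "S = (2 * w + w * \<epsilon> / \<delta>) + (1 + (w / \<epsilon> + 4 * y) / \<delta>) * (y * (1 + y) / real n)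
      + 1 / \<delta> * (y * (1 + y) * (1 + 2 * y) / (real n)\<^sup>2)"
  have p: "(\<lambda>k. W * (p k * negbin_weight n y k)) sums (W * S)"
    unfolding p_def S_def d_def by (intro sums_mult negbin_weight_cubic_sums n y)
  have gp: "\<bar>g (real k / real n) - f x\<bar> \<le> W * p k" for k
  proof -
    have yd: "y + d k = real k / real n" by (simp add: d_def)
    have "\<bar>g (real k / real n) - f x\<bar> \<le> W * ((1 + \<bar>d k\<bar> / \<delta>) * (w + (1 + (y + d k)\<^sup>2)))"
      using g_bound[of "real k / real n"] unfolding yd gx by (simp add: d_def mult_ac)
    also have "\<dots> \<le> W * (2 * w + 2 * y * d k + (d k)\<^sup>2
        + (w * \<epsilon> + (w / \<epsilon> + 4 * y) * (d k)\<^sup>2 + d k ^ 3) / \<delta>)"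
      unfolding w_def by (intro mult_left_mono weighted_dist_le_cubic W y \<epsilon> \<delta>) (simp add: yd)
    also have "\<dots> = W * p k"
      by (simp add: p_def algebra_simps add_divide_distrib)
    finally show ?thesis .
  qed
  have term_eq: "baskakov_term \<rho> n f x k = g (real k / real n) * negbin_weight n y k" for k
    by (simp add: baskakov_term_def g_def negbin_weight_def y_def)
  have "baskakov_term \<rho> n f x sums baskakov \<rho> n f x"
    using summable_baskakov_term[OF \<rho> f n x] unfolding baskakov_def by (rule summable_sums)
  from sums_diff[OF this sums_mult[OF negbin_weight_sums[OF n y], of "f x"]]
  have sums: "(\<lambda>k. (g (real k / real n) - f x) * negbin_weight n y k) sums (baskakov \<rho> n f x - f x)"
    by (simp add: term_eq algebra_simps)
  have "\<bar>baskakov \<rho> n f x - f x\<bar>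
      = norm (\<Sum>k. (g (real k / real n) - f x) * negbin_weight n y k)"
    using sums_unique[OF sums] by simp
  also have "\<dots> \<le> (\<Sum>k. W * (p k * negbin_weight n y k))"
  proof (rule norm_suminf_le[OF _ sums_summable[OF p]])
    fix k
    show "norm ((g (real k / real n) - f x) * negbin_weight n y k) \<le> W * (p k * negbin_weight n y k)"
      using mult_right_mono[OF gp negbin_weight_nonneg[OF y]] negbin_weight_nonneg[OF y, of n k]
      by (simp add: abs_mult mult.assoc)
  qed
  also have "\<dots> = W * S" using sums_unique[OF p] by simp
  also have "\<dots> \<le> W * ((7 + 4 / real n) * w powr (3/2))"
    unfolding S_def w_def \<epsilon>_def \<delta>_def by (intro mult_left_mono cubic_mean_le W y n)
  finally show ?thesis by (simp add: weight_def w_def y_def mult_ac)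
qed

theorem theorem4:
  fixes \<rho> f :: "real \<Rightarrow> real" and n :: nat
  assumes "admissible \<rho>"
    and "f \<in> C_space (weight \<rho>)"
    and "n \<ge> 1"
  shows "weighted_norm (\<lambda>x. weight \<rho> x powr (3/2)) (\<lambda>x. baskakov \<rho> n f x - f x)
      \<le> ereal (7 + 4 / real n)
          * weighted_modulus \<rho> f (2 * sqrt 2 / sqrt (real n) + 16 / real n)"
proof -
  define \<delta> where "\<delta> = 2 * sqrt 2 / sqrt (real n) + 16 / real n"
  have \<delta>: "\<delta> > 0" using assms(3) by (simp add: \<delta>_def add_pos_pos)
  have w: "weight \<rho> x > 0" for x by (simp add: weight_def add_pos_nonneg)
  obtain W where W: "weighted_modulus \<rho> f \<delta> = ereal W"
    using weighted_modulus_finite[OF assms(2) \<delta>] by auto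
  have le: "\<bar>f t - f x\<bar> / (weight \<rho> t + weight \<rho> x) \<le> W"
    if "x \<ge> 0" "t \<ge> 0" "\<bar>\<rho> x - \<rho> t\<bar> \<le> \<delta>" for x t
  proof -
    have "ereal (\<bar>f t - f x\<bar> / (weight \<rho> t + weight \<rho> x)) \<le> weighted_modulus \<rho> f \<delta>"
      unfolding weighted_modulus_def by (rule SUP_upper2[of "(x, t)"]) (use that in auto)
    then show ?thesis by (simp add: W)
  qed
  \<comment> \<open>At \<open>x = t = 0\<close> the quotient is 0, so its upper bound
    \<open>W\<close> is nonnegative.\<close>
  have W0: "W \<ge> 0" using le[of 0 0] \<delta> by simp
  have near: "\<bar>f t - f x\<bar> \<le> W * (weight \<rho> x + weight \<rho> t)"
    if "x \<ge> 0" "t \<ge> 0" "\<bar>\<rho> x - \<rho> t\<bar> \<le> \<delta>" for x t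
    using le[OF that] w[of x] w[of t] by (simp add: divide_le_eq add_pos_pos add_ac)
  have "\<bar>baskakov \<rho> n f x - f x\<bar> / weight \<rho> x powr (3/2) \<le> (7 + 4 / real n) * W" if "x \<ge> 0" for x
  proof -
    have "weight \<rho> x powr (3/2) > 0" using w[of x] by simp
    then show ?thesis
      using baskakov_diff_bound[OF assms that W0 \<delta>_def near] by (simp add: divide_le_eq mult_ac)
  qed
  then show ?thesis
    unfolding weighted_norm_def \<delta>_def[symmetric] W by (intro SUP_least) auto
qed

end
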